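(* Let $0<\alpha <1$, $-1<B\leq 0$ and $B<A\leq 1$. Suppose that neither of the following two conditions holds: (i) $(1-\alpha)(1+6\alpha+\alpha^2)|B|(A-B)\leq 4\alpha (1-B^2)$ and $(1+\alpha)^2\left(4\alpha (A-B)^2 +B^2\right)\leq 4\alpha$; (ii) $(1-\alpha)(1+6\alpha+\alpha^2)|B|(A-B)\geq 4\alpha (1-B^2)$ and $(1-\alpha)(A-B)+|B|\leq 1$. Then the Booth lemniscate starlikeness radius of order $\alpha$ for the class $\mathcal{S}^{*}[A,B]$ is $$R_{\mathcal{BS}(\alpha)}(\mathcal{S}^{*}[A,B])=\begin{cases}\min \left\{1,\ \dfrac{2\sqrt{\alpha}}{(1+\alpha)\sqrt{4\alpha (A-B)^2 +B^2}}\right\}, & 4A \alpha \geq (5\alpha-1)B,\\[3mm] \min \left\{1,\ \dfrac{1}{(1-\alpha)(A-B)-B}\right\}, & 4A \alpha\leq (5\alpha-1)B.\end{cases}$$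
   Context: $\mathbb{D}=\{z\in\mathbb{C}:|z|<1\}$. $\mathcal{A}$ is the class of analytic functions $f$ on $\mathbb{D}$ with $f(0)=0$, $f'(0)=1$. For analytic $p,q$ on $\mathbb{D}$, $p\prec q$ (subordination) means $p=q\circ w$ for some analytic $w:\mathbb{D}\to\mathbb{D}$ with $w(0)=0$. The expression $zf'(z)/f(z)$ takes the value $1$ at $z=0$; in conditions on it, it is understood to be analytic. For $0\le\alpha<1$, $G_\alpha(z)=1+\dfrac{z}{1-\alpha z^2}$ on $\mathbb{D}$. For a class $\mathcal{M}\subseteq\mathcal{A}$ and $f\in\mathcal{M}$ let $$R_f=\sup\left\{r\in(0,1): \frac{zf'(z)}{f(z)}\in G_\alpha(\mathbb{D})\text{ for all }|z|\le r\right\},\qquad R_{\mathcal{BS}(\alpha)}(\mathcal{M})=\inf\{R_f: f\in\mathcal{M}\}.$$ The number $R_{\mathcal{BS}(\alpha)}(\mathcal{M})$ is called the Booth lemniscate starlikeness radius of order $\alpha$ of $\mathcal{M}$. For $-1\le B<A\le1$, the Janowski class $\mathcal{S}^*[A,B]$ consists of the $f\in\mathcal{A}$ with $zf'(z)/f(z)\prec \dfrac{1+Az}{1+Bz}$. *)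

theory Defs
  imports "HOL-Complex_Analysis.Complex_Analysis"
begin

abbreviation unit_disc :: "complex set" where
  "unit_disc \<equiv> ball 0 1"

text \<open>Functions on the unit disc are total functions on \<^typ>\<open>complex\<close>; only their
  values on the disc matter.\<close>

definition normalized_analytic :: "(complex \<Rightarrow> complex) set" where
  "normalized_analytic = {f. f holomorphic_on unit_disc \<and> f 0 = 0 \<and> deriv f 0 = 1}"

definition subordinate :: "(complex \<Rightarrow> complex) \<Rightarrow> (complex \<Rightarrow> complex) \<Rightarrow> bool" where
  "subordinate p q \<longleftrightarrow>
     p holomorphic_on unit_disc \<and> q holomorphic_on unit_disc \<and>
     (\<exists>w. w holomorphic_on unit_disc \<and> w ` unit_disc \<subseteq> unit_disc \<and> w 0 = 0 \<and>
          (\<forall>z\<in>unit_disc. p z = q (w z)))"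

text \<open>The quotient \<open>z f'(z) / f(z)\<close>, with its removable singularity at the origin filled in.
  At a zero of \<open>f\<close> other than the origin HOL division yields \<open>0\<close>, but the true quotient has a
  pole there. So where this function is required to be analytic, \<open>f\<close> has no such zeros.\<close>

definition log_quotient :: "(complex \<Rightarrow> complex) \<Rightarrow> complex \<Rightarrow> complex" where
  "log_quotient f z = (if z = 0 then 1 else z * deriv f z / f z)"

definition janowski_class :: "real \<Rightarrow> real \<Rightarrow> (complex \<Rightarrow> complex) set" where
  "janowski_class A B =
     {f \<in> normalized_analytic.
        subordinate (log_quotient f) (\<lambda>z. (1 + of_real A * z) / (1 + of_real B * z))}"

definition booth_fun :: "real \<Rightarrow> complex \<Rightarrow> complex" where
  "booth_fun \<alpha> z = 1 + z / (1 - of_real \<alpha> * z\<^sup>2)"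

text \<open>Analyticity is demanded explicitly because the junk value \<open>0\<close> of the quotient at a nonzero
  zero of \<open>f\<close> may lie in the image of \<open>booth_fun\<close>.
  For \<open>0 \<le> \<alpha> < 1\<close> and \<open>f\<close> in \<open>normalized_analytic\<close> the set below is nonempty, as its image
  domain is an open neighbourhood of \<open>1\<close>, so \<open>Sup\<close> is a genuine supremum.\<close>

definition booth_radius_of :: "real \<Rightarrow> (complex \<Rightarrow> complex) \<Rightarrow> real" where
  "booth_radius_of \<alpha> f =
     Sup {r. 0 < r \<and> r < 1 \<and> log_quotient f analytic_on cball 0 r \<and>
             (\<forall>z. norm z \<le> r \<longrightarrow> log_quotient f z \<in> booth_fun \<alpha> ` unit_disc)}"

definition booth_starlike_radius :: "real \<Rightarrow> (complex \<Rightarrow> complex) set \<Rightarrow> real" where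
  "booth_starlike_radius \<alpha> M = Inf {booth_radius_of \<alpha> f | f. f \<in> M}"

end

theory Submission
  imports Defs
begin

text \<open>Put \<open>s = A - B\<close>. For \<open>v \<noteq> 0\<close> the point \<open>1 + 1/v\<close> lies in the image of \<open>booth_fun \<alpha>\<close> iff
  \<open>v = 1/z - \<alpha> z\<close> for some \<open>z \<noteq> 0\<close> in the disc, i.e. iff \<open>v\<close> lies outside the closed ellipse with
  semi-axes \<open>1 - \<alpha>\<close> and \<open>1 + \<alpha>\<close>. A value \<open>1 + 1/v\<close> of the Janowski function at \<open>w\<close> has
  \<open>s v - B = 1/w\<close>. So the disc of radius \<open>r\<close> is mapped into the Booth domain iff \<open>r M < 1\<close>, where
  \<open>M\<close> is the largest distance from \<open>B\<close> to a point of the ellipse scaled by \<open>s\<close>. With \<open>x\<close> the cosine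
  of the eccentric angle, \<open>M\<^sup>2\<close> is the maximum over \<open>[-1, 1]\<close> of a concave quadratic in \<open>x\<close>; the two
  cases of the theorem correspond to its vertex lying inside or to the right of that interval.\<close>

section \<open>The map \<open>z \<mapsto> 1/z - \<alpha> z\<close> and the ellipse\<close>

text \<open>In polar form \<open>Re v\<close> and \<open>Im v\<close> are the cosine and minus the
  sine of the argument of \<open>z\<close>, scaled by \<open>1/\<rho> - \<alpha> \<rho>\<close> and
  \<open>1/\<rho> + \<alpha> \<rho>\<close>. For \<open>\<rho>\<close> between \<open>1\<close> and
  \<open>1/\<alpha>\<close> these factors have modulus at most \<open>1 - \<alpha>\<close> and
  \<open>1 + \<alpha>\<close>; \<open>c\<close> is the cosine.\<close>

lemma joukowski_annulus_in_ellipse: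
  fixes \<alpha> :: real and z v :: complex
  assumes "0 < \<alpha>" "1 \<le> norm z" "\<alpha> * norm z \<le> 1" and v: "v = 1 / z - of_real \<alpha> * z"
  obtains c where "\<bar>Re v\<bar> \<le> (1 - \<alpha>) * \<bar>c\<bar>" "(Im v)\<^sup>2 \<le> (1 + \<alpha>)\<^sup>2 * (1 - c\<^sup>2)" "\<bar>c\<bar> \<le> 1"
proof -
  define \<rho> where "\<rho> = norm z"
  define c d where "c = Re z / \<rho>" and "d = Im z / \<rho>"
  have \<rho>: "1 \<le> \<rho>" "\<alpha> * \<rho> \<le> 1" and "\<rho> > 0"
    using assms by (auto simp: \<rho>_def)
  have \<rho>2: "\<rho>\<^sup>2 = (Re z)\<^sup>2 + (Im z)\<^sup>2"
    by (simp add: \<rho>_def cmod_power2)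
  have cd: "c\<^sup>2 + d\<^sup>2 = 1"
    using \<open>\<rho> > 0\<close> by (simp add: c_def d_def power_divide \<rho>2[symmetric] flip: add_divide_distrib)
  have z: "Re z = c * \<rho>" "Im z = d * \<rho>"
    using \<open>\<rho> > 0\<close> by (auto simp: c_def d_def)
  have "Re (1 / z) = Re z / \<rho>\<^sup>2" "Im (1 / z) = - Im z / \<rho>\<^sup>2"
    by (simp_all add: Re_divide Im_divide \<rho>2)
  then have inv: "Re (1 / z) = c / \<rho>" "Im (1 / z) = - d / \<rho>"
    using \<open>\<rho> > 0\<close> by (simp_all add: z power2_eq_square)
  have re: "Re v = c * (1 / \<rho> - \<alpha> * \<rho>)" and im: "Im v = - d * (1 / \<rho> + \<alpha> * \<rho>)"
    by (simp_all add: v inv z algebra_simps)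
  have b: "\<alpha> \<le> 1 / \<rho>" "1 / \<rho> \<le> 1" "\<alpha> \<le> \<alpha> * \<rho>"
    using \<rho> \<open>\<rho> > 0\<close> \<open>0 < \<alpha>\<close> by (auto simp: field_simps)
  have "\<bar>1 / \<rho> - \<alpha> * \<rho>\<bar> \<le> 1 - \<alpha>"
    using b \<rho> by linarith
  then have 1: "\<bar>Re v\<bar> \<le> (1 - \<alpha>) * \<bar>c\<bar>"
    unfolding re abs_mult mult.commute[of "\<bar>c\<bar>"] by (rule mult_right_mono) simp
  \<comment> \<open>Expanding this product gives exactly
    \<open>1 + \<alpha> - (1/\<rho> + \<alpha> \<rho>)\<close>.\<close>
  have "(\<rho> - 1) * (1 / \<rho> - \<alpha>) \<ge> 0"
    using b \<rho> by simp
  then have "1 / \<rho> + \<alpha> * \<rho> \<le> 1 + \<alpha>"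
    using \<open>\<rho> > 0\<close> by (simp add: algebra_simps diff_divide_distrib)
  then have "(1 / \<rho> + \<alpha> * \<rho>)\<^sup>2 \<le> (1 + \<alpha>)\<^sup>2"
    using \<open>\<rho> > 0\<close> \<open>0 < \<alpha>\<close> by (intro power_mono) auto
  then have "d\<^sup>2 * (1 / \<rho> + \<alpha> * \<rho>)\<^sup>2 \<le> d\<^sup>2 * (1 + \<alpha>)\<^sup>2"
    by (rule mult_left_mono) simp
  moreover have "d\<^sup>2 = 1 - c\<^sup>2"
    using cd by simp
  ultimately have 2: "(Im v)\<^sup>2 \<le> (1 + \<alpha>)\<^sup>2 * (1 - c\<^sup>2)"
    unfolding im power_mult_distrib by (simp add: mult.commute)
  have "c\<^sup>2 \<le> 1"
    using cd zero_le_power2[of d] by linarith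
  then have "\<bar>c\<bar> \<le> 1"
    by (simp add: abs_square_le_1)
  with 1 2 show thesis
    by (rule that)
qed

text \<open>The preimages of \<open>v\<close> are the roots of
  \<open>\<alpha> z^2 + v z - 1\<close>, whose product is \<open>-1/\<alpha>\<close>. If neither
  root lies in the open disc, each has modulus between \<open>1\<close> and
  \<open>1/\<alpha>\<close>.\<close>

lemma joukowski_disc_preimage:
  fixes \<alpha> :: real and v :: complex
  assumes "0 < \<alpha>"
  obtains z where "v = 1 / z - of_real \<alpha> * z" "z \<noteq> 0" "norm z < 1"
  | z where "v = 1 / z - of_real \<alpha> * z" "1 \<le> norm z" "\<alpha> * norm z \<le> 1"
proof -
  define d where "d = csqrt (v\<^sup>2 + 4 * of_real \<alpha>)"
  have d: "d\<^sup>2 = v\<^sup>2 + 4 * of_real \<alpha>"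
    by (simp add: d_def)
  define z1 z2 where "z1 = (d - v) / (2 * of_real \<alpha>)" and "z2 = (- d - v) / (2 * of_real \<alpha>)"
  have a0: "complex_of_real \<alpha> \<noteq> 0"
    using assms by simp
  have prod: "of_real \<alpha> * z1 * z2 = -1"
    using a0 d by (simp add: z1_def z2_def divide_simps) (simp add: algebra_simps flip: power2_eq_square)
  have sum: "v = - of_real \<alpha> * (z1 + z2)"
    using a0 by (simp add: z1_def z2_def divide_simps)
  have nz: "z1 \<noteq> 0" "z2 \<noteq> 0"
    using prod by auto
  have inv: "1 / z1 = - of_real \<alpha> * z2" "1 / z2 = - of_real \<alpha> * z1"
    using prod nz by (simp_all add: divide_simps) (simp_all add: algebra_simps)
  have v: "v = 1 / z1 - of_real \<alpha> * z1" "v = 1 / z2 - of_real \<alpha> * z2"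
    unfolding inv sum by (simp_all add: algebra_simps)
  have "norm (of_real \<alpha> * z1 * z2) = 1"
    unfolding prod by simp
  then have n: "\<alpha> * norm z1 * norm z2 = 1"
    using assms by (simp add: norm_mult)
  consider (1) "norm z1 < 1" | (2) "norm z2 < 1" | (3) "1 \<le> norm z1" "1 \<le> norm z2"
    by linarith
  then show thesis
  proof cases
    case 1
    then show thesis by (rule that(1)[OF v(1) nz(1)])
  next
    case 2
    then show thesis by (rule that(1)[OF v(2) nz(2)])
  next
    case 3
    then have "\<alpha> * norm z1 * 1 \<le> \<alpha> * norm z1 * norm z2"
      using assms by (intro mult_left_mono) auto
    then have "\<alpha> * norm z1 \<le> 1"
      using n by simp
    with 3 show thesis
      by (intro that(2)[OF v(1)])
  qed
qed

text \<open>The squared distance from \<open>B\<close> to the points with eccentric angle \<open>arccos x\<close> of the ellipse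
  with semi-axes \<open>s (1 - \<alpha>)\<close> and \<open>s (1 + \<alpha>)\<close>.\<close>

definition ellipse_dist2 :: "real \<Rightarrow> real \<Rightarrow> real \<Rightarrow> real \<Rightarrow> real" where
  "ellipse_dist2 \<alpha> s B x = (s * (1 - \<alpha>) * x - B)\<^sup>2 + (s * (1 + \<alpha>))\<^sup>2 * (1 - x\<^sup>2)"

section \<open>Membership in the Booth domain\<close>

text \<open>Either \<open>v\<close> has a preimage in the disc, which is then a Booth preimage of
  \<open>1 + 1/v\<close>, or \<open>v\<close> lies in the closed ellipse, whose scaled points are
  within \<open>M\<close> of \<open>B\<close>.\<close>

lemma inverse_in_booth_image:
  fixes \<alpha> s B M :: real and v :: complex
  assumes "0 < \<alpha>" "\<alpha> < 1"
    and max: "\<And>x. \<bar>x\<bar> \<le> 1 \<Longrightarrow> ellipse_dist2 \<alpha> s B x \<le> M\<^sup>2"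
    and "0 \<le> M" and far: "M < norm (of_real s * v - of_real B)"
  shows "1 + 1 / v \<in> booth_fun \<alpha> ` unit_disc"
  using \<open>0 < \<alpha>\<close>
proof (rule joukowski_disc_preimage[where v = v])
  fix z assume z: "v = 1 / z - of_real \<alpha> * z" "z \<noteq> 0" "norm z < 1"
  then have "v = (1 - of_real \<alpha> * z\<^sup>2) / z"
    by (simp add: power2_eq_square field_simps)
  then have "1 / v = z / (1 - of_real \<alpha> * z\<^sup>2)"
    by simp
  then have "1 + 1 / v = booth_fun \<alpha> z"
    by (simp add: booth_fun_def)
  with z show ?thesis by auto
next
  fix z assume z: "v = 1 / z - of_real \<alpha> * z" "1 \<le> norm z" "\<alpha> * norm z \<le> 1"
  obtain c where c: "\<bar>Re v\<bar> \<le> (1 - \<alpha>) * \<bar>c\<bar>" "(Im v)\<^sup>2 \<le> (1 + \<alpha>)\<^sup>2 * (1 - c\<^sup>2)" "\<bar>c\<bar> \<le> 1"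
    using joukowski_annulus_in_ellipse[OF \<open>0 < \<alpha>\<close> z(2,3,1)] by blast
  \<comment> \<open>This selects the boundary points of the ellipse with the same real part as
    \<open>v\<close>. Since \<open>B\<close> is real, moving \<open>v\<close> vertically out to the
    boundary does not decrease the distance to \<open>B\<close>.\<close>
  define x where "x = Re v / (1 - \<alpha>)"
  have re: "Re v = (1 - \<alpha>) * x"
    using \<open>\<alpha> < 1\<close> by (simp add: x_def)
  have xc: "\<bar>x\<bar> \<le> \<bar>c\<bar>"
    using c(1) \<open>\<alpha> < 1\<close> by (simp add: re abs_mult)
  then have "1 - c\<^sup>2 \<le> 1 - x\<^sup>2"
    by (simp add: abs_le_square_iff)
  then have "(Im v)\<^sup>2 \<le> (1 + \<alpha>)\<^sup>2 * (1 - x\<^sup>2)"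
    using c(2) by (meson mult_left_mono order_trans zero_le_power2)
  then have "s\<^sup>2 * (Im v)\<^sup>2 \<le> s\<^sup>2 * ((1 + \<alpha>)\<^sup>2 * (1 - x\<^sup>2))"
    by (rule mult_left_mono) simp
  then have "(norm (of_real s * v - of_real B))\<^sup>2 \<le> ellipse_dist2 \<alpha> s B x"
    by (simp add: cmod_power2 re ellipse_dist2_def power_mult_distrib mult.assoc)
  also have "\<dots> \<le> M\<^sup>2"
    using xc c(3) by (intro max) simp
  finally show ?thesis
    using far \<open>0 \<le> M\<close> by (meson norm_ge_zero not_le power2_le_imp_le)
qed

text \<open>The Booth function takes no value of the unit circle again inside the disc: equality of
  two values gives \<open>(\<zeta> - z) (1 + \<alpha> z \<zeta>) = 0\<close>, and neither factor
  vanishes when \<open>|z| < 1 = |\<zeta>|\<close>.\<close>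

lemma booth_boundary_not_in_image:
  fixes \<alpha> :: real and \<zeta> :: complex
  assumes "0 < \<alpha>" "\<alpha> < 1" "norm \<zeta> = 1"
  shows "1 + 1 / (1 / \<zeta> - of_real \<alpha> * \<zeta>) \<notin> booth_fun \<alpha> ` unit_disc"
proof
  assume "1 + 1 / (1 / \<zeta> - of_real \<alpha> * \<zeta>) \<in> booth_fun \<alpha> ` unit_disc"
  then obtain z where z: "norm z < 1"
    and eq: "1 / (1 / \<zeta> - of_real \<alpha> * \<zeta>) = z / (1 - of_real \<alpha> * z\<^sup>2)"
    by (auto simp: booth_fun_def)
  have ne: "1 - of_real \<alpha> * w\<^sup>2 \<noteq> 0" if "norm w \<le> 1" for w :: complex
  proof
    assume "1 - of_real \<alpha> * w\<^sup>2 = 0"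
    then have "norm (of_real \<alpha> * w\<^sup>2) = 1"
      by (metis eq_iff_diff_eq_0 norm_one)
    moreover have "norm (of_real \<alpha> * w\<^sup>2) \<le> \<alpha> * 1"
      using that \<open>0 < \<alpha>\<close> by (simp add: norm_mult norm_power power_le_one)
    ultimately show False using \<open>\<alpha> < 1\<close> by simp
  qed
  have "\<zeta> \<noteq> 0" using assms by auto
  then have "1 / (1 / \<zeta> - of_real \<alpha> * \<zeta>) = \<zeta> / (1 - of_real \<alpha> * \<zeta>\<^sup>2)"
    by (simp add: power2_eq_square divide_simps mult.assoc)
  with eq ne[of z] ne[of \<zeta>] z assms(3)
  have "\<zeta> * (1 - of_real \<alpha> * z\<^sup>2) = z * (1 - of_real \<alpha> * \<zeta>\<^sup>2)"
    by (simp add: frac_eq_eq)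
  then have "(\<zeta> - z) * (1 + of_real \<alpha> * z * \<zeta>) = 0"
    by (simp add: algebra_simps power2_eq_square)
  then have "of_real \<alpha> * z * \<zeta> = -1"
    using z assms(3) by (auto simp: add_eq_0_iff)
  then have "norm (of_real \<alpha> * z * \<zeta>) = 1"
    by simp
  then have "\<alpha> * norm z = 1"
    using assms by (simp add: norm_mult)
  moreover have "\<alpha> * norm z < 1 * 1"
    using assms z by (intro mult_strict_mono) auto
  ultimately show False by simp
qed

section \<open>The Janowski class and its extremal function\<close>

lemma janowski_denom_nonzero:
  fixes B :: real and w :: complex
  assumes "\<bar>B\<bar> < 1" "norm w < 1"
  shows "1 + of_real B * w \<noteq> 0"
proof
  assume "1 + of_real B * w = 0"
  then have "norm (of_real B * w) = 1"
    by (metis add_eq_0_iff norm_minus_cancel norm_one)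
  moreover have "norm (of_real B * w) \<le> \<bar>B\<bar> * 1"
    using assms by (simp add: norm_mult mult_left_le)
  ultimately show False using assms by simp
qed

lemma janowski_fun_eq:
  fixes A B :: real and w :: complex
  assumes "1 + of_real B * w \<noteq> 0" "w \<noteq> 0"
  shows "(1 + of_real A * w) / (1 + of_real B * w) = 1 + 1 / ((1 / w + of_real B) / of_real (A - B))"
  using assms by (simp add: divide_simps) (simp add: algebra_simps)

text \<open>The required logarithmic derivative is \<open>1/z + (A - B) / (1 + B z)\<close>, so
  \<open>f\<close> is \<open>z\<close> times the exponential of a primitive of the second term.
  Working with a primitive treats \<open>B = 0\<close> and \<open>B \<noteq> 0\<close>
  alike.\<close>

lemma janowski_extremal:
  fixes A B :: real
  assumes "\<bar>B\<bar> < 1"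
  obtains f where "f \<in> janowski_class A B"
    "\<And>z. norm z < 1 \<Longrightarrow> log_quotient f z = (1 + of_real A * z) / (1 + of_real B * z)"
proof -
  let ?P = "\<lambda>z::complex. (1 + of_real A * z) / (1 + of_real B * z)"
  let ?h' = "\<lambda>z::complex. of_real (A - B) / (1 + of_real B * z)"
  have nz: "1 + of_real B * z \<noteq> 0" if "norm z < 1" for z :: complex
    using janowski_denom_nonzero assms that by blast
  have "?h' holomorphic_on unit_disc" and P: "?P holomorphic_on unit_disc"
    by (auto intro!: holomorphic_intros simp: nz)
  then obtain g where g: "\<And>z. z \<in> unit_disc \<Longrightarrow> (g has_field_derivative ?h' z) (at z)"
    using holomorphic_convex_primitive'[of unit_disc ?h']
    by (metis at_within_open convex_ball open_ball)
  define f where "f = (\<lambda>z. z * exp (g z - g 0))"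
  have f': "(f has_field_derivative (exp (g z - g 0) * ?P z)) (at z)" if "norm z < 1" for z
  proof -
    have "(f has_field_derivative (exp (g z - g 0) + z * (exp (g z - g 0) * ?h' z))) (at z)"
      unfolding f_def using that by (auto intro!: derivative_eq_intros g)
    moreover have "1 + z * ?h' z = ?P z"
      using nz[OF that] by (simp add: divide_simps) (simp add: algebra_simps)
    then have "exp (g z - g 0) + z * (exp (g z - g 0) * ?h' z) = exp (g z - g 0) * ?P z"
      by (metis distrib_left mult.left_commute mult.right_neutral)
    ultimately show ?thesis by simp
  qed
  have lq: "log_quotient f z = ?P z" if "norm z < 1" for z
    using DERIV_imp_deriv[OF f'[OF that]] by (simp add: log_quotient_def f_def)
  have "f holomorphic_on unit_disc"
    unfolding holomorphic_on_open[OF open_ball] using f' by (metis dist_0_norm mem_ball)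
  moreover have "deriv f 0 = 1"
    using DERIV_imp_deriv[OF f'[of 0]] by simp
  ultimately have "f \<in> normalized_analytic"
    by (simp add: normalized_analytic_def f_def)
  moreover have "log_quotient f holomorphic_on unit_disc"
    using P by (rule holomorphic_transform) (simp add: lq)
  then have "subordinate (log_quotient f) ?P"
    unfolding subordinate_def using P lq
    by (auto intro!: exI[of _ "\<lambda>z. z"])
  ultimately have "f \<in> janowski_class A B"
    by (simp add: janowski_class_def)
  with lq that show thesis by blast
qed

section \<open>Bounds for the radius and their agreement\<close>

definition booth_radii :: "real \<Rightarrow> (complex \<Rightarrow> complex) \<Rightarrow> real set" where
  "booth_radii \<alpha> f = {r. 0 < r \<and> r < 1 \<and> log_quotient f analytic_on cball 0 r \<and>
     (\<forall>z. norm z \<le> r \<longrightarrow> log_quotient f z \<in> booth_fun \<alpha> ` unit_disc)}"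

lemma booth_radius_of_eq_Sup: "booth_radius_of \<alpha> f = Sup (booth_radii \<alpha> f)"
  by (simp add: booth_radius_of_def booth_radii_def)

text \<open>By the Schwarz lemma \<open>|w z| \<le> |z| \<le> r < 1/M\<close>, so
  \<open>1 / w z\<close> has modulus above \<open>M\<close>. This modulus is the distance from
  \<open>B\<close> to the scaled \<open>v\<close>.\<close>

lemma mem_booth_radii_janowski:
  fixes \<alpha> A B M :: real
  assumes "0 < \<alpha>" "\<alpha> < 1" "\<bar>B\<bar> < 1" "B < A" "0 < M"
    and max: "\<And>x. \<bar>x\<bar> \<le> 1 \<Longrightarrow> ellipse_dist2 \<alpha> (A - B) B x \<le> M\<^sup>2"
    and f: "f \<in> janowski_class A B"
    and r: "0 < r" "r < min 1 (1 / M)"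
  shows "r \<in> booth_radii \<alpha> f"
proof -
  let ?P = "\<lambda>z::complex. (1 + of_real A * z) / (1 + of_real B * z)"
  obtain w where hol: "log_quotient f holomorphic_on unit_disc"
    and w: "w holomorphic_on unit_disc" "w ` unit_disc \<subseteq> unit_disc" "w 0 = 0"
    and eq: "\<And>z. z \<in> unit_disc \<Longrightarrow> log_quotient f z = ?P (w z)"
    using f by (auto simp: janowski_class_def subordinate_def)
  have "log_quotient f z \<in> booth_fun \<alpha> ` unit_disc" if z: "norm z \<le> r" for z
  \<comment> \<open>The form \<open>1 + 1/v\<close> needs \<open>w z \<noteq> 0\<close>; at a zero
    of \<open>w\<close> the Janowski value is \<open>1\<close>, the Booth value at
    \<open>0\<close>.\<close>
  proof (cases "w z = 0")
    case True
    have "booth_fun \<alpha> 0 = 1" by (simp add: booth_fun_def)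
    then show ?thesis
      using eq[of z] z r True by (auto intro!: image_eqI[of _ _ 0])
  next
    case False
    let ?v = "(1 / w z + of_real B) / of_real (A - B)"
    have z1: "norm z < 1" using z r by simp
    have "norm (w \<xi>) < 1" if "norm \<xi> < 1" for \<xi>
      using w(2) that by (auto simp: image_subset_iff)
    then have "norm (w z) \<le> norm z"
      using Schwarz_Lemma(1)[of w z] w z1 by auto
    then have wr: "norm (w z) \<le> r" using z by simp
    have "M < 1 / r"
      using r \<open>0 < M\<close> by (simp add: field_simps)
    also have "\<dots> \<le> 1 / norm (w z)"
      using wr False r by (intro divide_left_mono) auto
    also have "\<dots> = norm (of_real (A - B) * ?v - of_real B)"
      using \<open>B < A\<close> by (simp add: norm_divide flip: of_real_diff)
    finally have "1 + 1 / ?v \<in> booth_fun \<alpha> ` unit_disc"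
      using assms by (intro inverse_in_booth_image[where M = M and s = "A - B" and B = B]) auto
    moreover have "1 + of_real B * w z \<noteq> 0"
      using wr r \<open>\<bar>B\<bar> < 1\<close> by (intro janowski_denom_nonzero) auto
    ultimately show ?thesis
      using janowski_fun_eq[of B "w z" A] False eq[of z] z1 by simp
  qed
  moreover have "log_quotient f analytic_on cball 0 r"
    using hol r by (auto simp: analytic_on_holomorphic intro!: exI[of _ unit_disc])
  ultimately show ?thesis
    using r by (auto simp: booth_radii_def)
qed

text \<open>The ellipse point with parameter \<open>x\<close> comes from some \<open>\<zeta>\<close>
  on the unit circle and corresponds to a \<open>w\<close> of modulus \<open>1/M\<close>. There the
  quotient takes a Booth boundary value, so no admissible \<open>r\<close> reaches past
  \<open>|w|\<close>.\<close>

lemma booth_radii_le: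
  fixes \<alpha> A B M x :: real
  assumes "0 < \<alpha>" "\<alpha> < 1" "\<bar>B\<bar> < 1" "B < A" "0 < M" "\<bar>x\<bar> \<le> 1"
    and M: "M\<^sup>2 = ellipse_dist2 \<alpha> (A - B) B x"
    and lq: "\<And>z. norm z < 1 \<Longrightarrow> log_quotient f z = (1 + of_real A * z) / (1 + of_real B * z)"
    and r: "r \<in> booth_radii \<alpha> f"
  shows "r \<le> min 1 (1 / M)"
proof -
  define y where "y = sqrt (1 - x\<^sup>2)"
  have xy: "x\<^sup>2 + y\<^sup>2 = 1"
    using \<open>\<bar>x\<bar> \<le> 1\<close> by (simp add: y_def abs_square_le_1)
  define \<zeta> where "\<zeta> = Complex x y"
  have n\<zeta>: "norm \<zeta> = 1"
    by (simp add: \<zeta>_def cmod_def xy)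
  have "1 / \<zeta> = cnj \<zeta>"
    using n\<zeta> by (simp add: divide_conv_cnj)
  define v where "v = 1 / \<zeta> - of_real \<alpha> * \<zeta>"
  have v: "v = Complex ((1 - \<alpha>) * x) (- ((1 + \<alpha>) * y))"
    unfolding v_def \<open>1 / \<zeta> = cnj \<zeta>\<close> by (simp add: \<zeta>_def complex_eq_iff algebra_simps)
  define w where "w = 1 / (of_real (A - B) * v - of_real B)"
  have "(norm (of_real (A - B) * v - of_real B))\<^sup>2
      = ((A - B) * ((1 - \<alpha>) * x) - B)\<^sup>2 + ((A - B) * (1 + \<alpha>))\<^sup>2 * y\<^sup>2"
    by (simp add: cmod_power2 v power_mult_distrib mult.assoc flip: of_real_diff)
  also have "\<dots> = M\<^sup>2"
    using xy by (simp add: M ellipse_dist2_def mult.assoc eq_diff_eq)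
  finally have "norm (of_real (A - B) * v - of_real B) = M"
    using \<open>0 < M\<close> by simp
  then have nw: "norm w = 1 / M"
    by (simp only: w_def norm_divide norm_one)
  then have "w \<noteq> 0" using \<open>0 < M\<close> by auto
  have vw: "v = (1 / w + of_real B) / of_real (A - B)"
    using \<open>B < A\<close> by (simp add: w_def flip: of_real_diff)
  show ?thesis
  proof (rule ccontr)
    assume "\<not> r \<le> min 1 (1 / M)"
    with r nw have w: "norm w \<le> r" "norm w < 1" by (auto simp: booth_radii_def)
    have "log_quotient f w = 1 + 1 / v"
      using janowski_fun_eq[OF janowski_denom_nonzero[OF \<open>\<bar>B\<bar> < 1\<close> w(2)] \<open>w \<noteq> 0\<close>, of A] lq[OF w(2)]
      by (simp add: vw)
    also have "\<dots> \<notin> booth_fun \<alpha> ` unit_disc"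
      unfolding v_def using assms n\<zeta> by (intro booth_boundary_not_in_image) auto
    finally show False using r w by (auto simp: booth_radii_def)
  qed
qed

text \<open>When \<open>x\<close> maximises the distance, the lower bound for all of the class meets
  the upper bound for the extremal function, which therefore attains the infimum.\<close>

lemma booth_starlike_radius_janowski:
  fixes \<alpha> A B M x :: real
  assumes "0 < \<alpha>" "\<alpha> < 1" "\<bar>B\<bar> < 1" "B < A" "\<bar>x\<bar> \<le> 1" "0 < M"
    and M: "M\<^sup>2 = ellipse_dist2 \<alpha> (A - B) B x"
    and max: "\<And>t. \<bar>t\<bar> \<le> 1 \<Longrightarrow> ellipse_dist2 \<alpha> (A - B) B t \<le> ellipse_dist2 \<alpha> (A - B) B x"
  shows "booth_starlike_radius \<alpha> (janowski_class A B) = min 1 (1 / M)"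
proof -
  have pos: "0 < min 1 (1 / M)"
    using \<open>0 < M\<close> by simp
  have mem: "r \<in> booth_radii \<alpha> f" if "f \<in> janowski_class A B" "0 < r" "r < min 1 (1 / M)" for f r
    using assms that by (intro mem_booth_radii_janowski[where M = M and A = A and B = B]) auto
  have lower: "min 1 (1 / M) \<le> booth_radius_of \<alpha> f" if "f \<in> janowski_class A B" for f
    unfolding booth_radius_of_eq_Sup
  \<comment> \<open>Only radii strictly below the bound are known to be admissible, so the supremum
    is bounded below by density.\<close>
  proof (rule dense_le_bounded[OF pos])
    have "bdd_above (booth_radii \<alpha> f)"
      by (rule bdd_aboveI[of _ 1]) (auto simp: booth_radii_def)
    then show "r \<le> Sup (booth_radii \<alpha> f)" if "0 < r" "r < min 1 (1 / M)" for r
      using mem[OF \<open>f \<in> janowski_class A B\<close> that] by (intro cSup_upper)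
  qed
  obtain f where f: "f \<in> janowski_class A B"
    and lq: "\<And>z. norm z < 1 \<Longrightarrow> log_quotient f z = (1 + of_real A * z) / (1 + of_real B * z)"
    using janowski_extremal \<open>\<bar>B\<bar> < 1\<close> by blast
  have "booth_radius_of \<alpha> f \<le> min 1 (1 / M)"
    unfolding booth_radius_of_eq_Sup
  proof (rule cSup_least)
    show "booth_radii \<alpha> f \<noteq> {}"
      using mem[OF f] dense[OF pos] by blast
    show "r \<le> min 1 (1 / M)" if "r \<in> booth_radii \<alpha> f" for r
      using assms lq that by (intro booth_radii_le[where x = x and A = A and B = B])
  qed
  then have eq: "min 1 (1 / M) = booth_radius_of \<alpha> f"
    using lower[OF f] by linarith
  show ?thesis
    unfolding booth_starlike_radius_def
    by (rule cInf_eq_minimum) (use eq f lower in auto)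
qed

section \<open>Maximising the quadratic in the two cases\<close>

theorem theorem4p2:
  fixes \<alpha> A B :: real
  assumes "0 < \<alpha>" and "\<alpha> < 1"
    and "-1 < B" and "B \<le> 0" and "B < A" and "A \<le> 1"
    and not_i: "\<not> ((1 - \<alpha>) * (1 + 6 * \<alpha> + \<alpha>\<^sup>2) * \<bar>B\<bar> * (A - B) \<le> 4 * \<alpha> * (1 - B\<^sup>2) \<and>
                  (1 + \<alpha>)\<^sup>2 * (4 * \<alpha> * (A - B)\<^sup>2 + B\<^sup>2) \<le> 4 * \<alpha>)"
    and not_ii: "\<not> ((1 - \<alpha>) * (1 + 6 * \<alpha> + \<alpha>\<^sup>2) * \<bar>B\<bar> * (A - B) \<ge> 4 * \<alpha> * (1 - B\<^sup>2) \<and>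
                  (1 - \<alpha>) * (A - B) + \<bar>B\<bar> \<le> 1)"
  shows "(4 * A * \<alpha> \<ge> (5 * \<alpha> - 1) * B \<longrightarrow>
            booth_starlike_radius \<alpha> (janowski_class A B) =
              min 1 (2 * sqrt \<alpha> / ((1 + \<alpha>) * sqrt (4 * \<alpha> * (A - B)\<^sup>2 + B\<^sup>2)))) \<and>
         (4 * A * \<alpha> \<le> (5 * \<alpha> - 1) * B \<longrightarrow>
            booth_starlike_radius \<alpha> (janowski_class A B) =
              min 1 (1 / ((1 - \<alpha>) * (A - B) - B)))"
proof (intro conjI impI)
  define s where "s = A - B"
  have s: "s > 0" and B: "\<bar>B\<bar> < 1"
    using assms by (auto simp: s_def)
  have diff: "ellipse_dist2 \<alpha> s B x - ellipse_dist2 \<alpha> s B t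
      = 2 * s * (t - x) * (B * (1 - \<alpha>) + 2 * \<alpha> * s * (t + x))" for x t
    by (simp add: ellipse_dist2_def power2_eq_square algebra_simps)
  {
    assume le: "4 * A * \<alpha> \<ge> (5 * \<alpha> - 1) * B"
    define M where "M = (1 + \<alpha>) * sqrt (4 * \<alpha> * s\<^sup>2 + B\<^sup>2) / (2 * sqrt \<alpha>)"
    \<comment> \<open>The vertex of the concave quadratic. It is nonnegative because
      \<open>B \<le> 0\<close>, and \<open>x \<le> 1\<close> is the case hypothesis
      rearranged.\<close>
    define x where "x = - (B * (1 - \<alpha>)) / (4 * \<alpha> * s)"
    have Bx: "B * (1 - \<alpha>) = - (4 * \<alpha> * s * x)"
      using s \<open>0 < \<alpha>\<close> by (simp add: x_def)
    have "0 \<le> x"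
      unfolding x_def using s assms by (intro divide_nonneg_pos) (auto simp: mult_nonpos_nonneg)
    moreover have "- (B * (1 - \<alpha>)) \<le> 4 * \<alpha> * s"
      using le by (simp add: s_def algebra_simps)
    then have "x \<le> 1"
      unfolding x_def using s \<open>0 < \<alpha>\<close> by (subst pos_divide_le_eq) auto
    ultimately have "\<bar>x\<bar> \<le> 1" by simp
    \<comment> \<open>At the vertex the last factor in \<open>diff\<close> reduces to
      \<open>2 \<alpha> s (t - x)\<close>, leaving a nonnegative multiple of a square.\<close>
    have "ellipse_dist2 \<alpha> s B x - ellipse_dist2 \<alpha> s B t = 4 * \<alpha> * (s * (t - x))\<^sup>2" for t
      unfolding diff Bx by (simp add: power2_eq_square algebra_simps)
    then have max: "ellipse_dist2 \<alpha> s B t \<le> ellipse_dist2 \<alpha> s B x" for t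
      using \<open>0 < \<alpha>\<close> by (metis diff_ge_0_iff_ge mult_nonneg_nonneg zero_le_power2 less_imp_le zero_le_numeral)
    have "4 * \<alpha> * s\<^sup>2 + B\<^sup>2 > 0"
      using s \<open>0 < \<alpha>\<close> by (simp add: add_pos_nonneg)
    then have "M > 0"
      using \<open>0 < \<alpha>\<close> by (simp add: M_def)
    have "M\<^sup>2 = (1 + \<alpha>)\<^sup>2 * (4 * \<alpha> * s\<^sup>2 + B\<^sup>2) / (4 * \<alpha>)"
      using \<open>0 < \<alpha>\<close> by (simp add: M_def power_mult_distrib power_divide)
    also have "(1 + \<alpha>)\<^sup>2 * (4 * \<alpha> * s\<^sup>2 + B\<^sup>2)
        = 4 * \<alpha> * (s\<^sup>2 * (1 + \<alpha>)\<^sup>2 + B\<^sup>2) + (B * (1 - \<alpha>))\<^sup>2"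
      by (simp add: power2_eq_square algebra_simps)
    \<comment> \<open>The term \<open>(B (1 - \<alpha>))^2 = (4 \<alpha> s x)^2\<close> is split by
      \<open>Bx\<close> so that the bracket becomes the expanded \<open>ellipse_dist2\<close> at
      \<open>x\<close>.\<close>
    also have "\<dots> = 4 * \<alpha> * (s\<^sup>2 * (1 + \<alpha>)\<^sup>2 + B\<^sup>2 - 4 * \<alpha> * s\<^sup>2 * x\<^sup>2 - 2 * s * x * (B * (1 - \<alpha>)))"
      unfolding Bx by (simp add: power2_eq_square algebra_simps)
    also have "\<dots> = 4 * \<alpha> * ellipse_dist2 \<alpha> s B x"
      by (simp add: ellipse_dist2_def power2_eq_square algebra_simps)
    also have "\<dots> / (4 * \<alpha>) = ellipse_dist2 \<alpha> s B x"
      using \<open>0 < \<alpha>\<close> by simp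
    finally have "booth_starlike_radius \<alpha> (janowski_class A B) = min 1 (1 / M)"
      using assms B \<open>\<bar>x\<bar> \<le> 1\<close> \<open>M > 0\<close> max
      by (intro booth_starlike_radius_janowski[where x = x]) (auto simp: s_def)
    then show "booth_starlike_radius \<alpha> (janowski_class A B) =
        min 1 (2 * sqrt \<alpha> / ((1 + \<alpha>) * sqrt (4 * \<alpha> * (A - B)\<^sup>2 + B\<^sup>2)))"
      by (simp add: M_def s_def)
  }
  {
    assume le: "4 * A * \<alpha> \<le> (5 * \<alpha> - 1) * B"
    \<comment> \<open>Now the vertex is at or beyond \<open>1\<close>, so the maximum is at
      \<open>x = 1\<close>: \<open>M\<close> is the distance from \<open>B\<close> to the right end
      of the horizontal axis of the ellipse.\<close>
    define M where "M = s * (1 - \<alpha>) - B"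
    have "s * (1 - \<alpha>) > 0"
      using s \<open>\<alpha> < 1\<close> by simp
    then have "M > 0"
      unfolding M_def using \<open>B \<le> 0\<close> by linarith
    have max: "ellipse_dist2 \<alpha> s B t \<le> ellipse_dist2 \<alpha> s B 1" if "\<bar>t\<bar> \<le> 1" for t
    proof -
      \<comment> \<open>This and the case hypothesis make the last factor of \<open>diff\<close>
        nonpositive, as is \<open>t - 1\<close>.\<close>
      have "2 * \<alpha> * s * (t + 1) \<le> 2 * \<alpha> * s * 2"
        using that s \<open>0 < \<alpha>\<close> by (intro mult_left_mono) auto
      also have "\<dots> \<le> - (B * (1 - \<alpha>))"
        using le by (simp add: s_def algebra_simps)
      finally have "0 \<le> 2 * s * (t - 1) * (B * (1 - \<alpha>) + 2 * \<alpha> * s * (t + 1))"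
        using that s by (intro mult_nonpos_nonpos[OF mult_nonneg_nonpos]) auto
      then show ?thesis
        using diff[of 1 t] by simp
    qed
    have "M\<^sup>2 = ellipse_dist2 \<alpha> s B 1"
      by (simp add: M_def ellipse_dist2_def)
    then have "booth_starlike_radius \<alpha> (janowski_class A B) = min 1 (1 / M)"
      using assms B \<open>M > 0\<close> max
      by (intro booth_starlike_radius_janowski[where x = 1]) (auto simp: s_def)
    then show "booth_starlike_radius \<alpha> (janowski_class A B) = min 1 (1 / ((1 - \<alpha>) * (A - B) - B))"
      by (simp add: M_def s_def mult.commute)
  }
qed

end
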